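(* Let $(\Omega,T,\mu,\mathcal{D},\{I_d\}_{d\in\mathcal{D}})$ be an ergodic fibred system (as defined in the context) such that the digit set $\mathcal{D}$ is finite, $\lambda_d>0$ for every $d\in\mathcal{D}$, and there are constants $0<c_1\le c_2$ such that for every $k\ge 1$ and every string $s=[a_1,a_2,\dots,a_k]$ of digits from $\mathcal{D}$, $$c_1\,\lambda_{a_1}\lambda_{a_2}\cdots\lambda_{a_k}\ \le\ \lambda_s\ \le\ c_2\,\lambda_{a_1}\lambda_{a_2}\cdots\lambda_{a_k}.$$ Let $S=\{s_n\}_{n\in\mathbb{N}}$ be an enumeration of all finite (non-empty) strings of digits from $\mathcal{D}$, each string listed exactly once, such that $\lambda_{s_i}>\lambda_{s_j}$ implies $i<j$ (strings whose cylinder sets have equal measure may be ordered in any way relative to each other). Let $x_S=[d_1,d_2,d_3,\dots]$ be the infinite digit sequence obtained by concatenating the strings $s_1,s_2,s_3,\dots$ in this order. Then $x_S$ is $T$-normal, i.e. for every $k\ge1$ and every string $s=[a_1,\dots,a_k]$ of digits from $\mathcal{D}$, $$\lim_{N\to\infty}\frac{\#\{0\le n\le N-k \mid d_{n+i}=a_i,\ 1\le i\le k\}}{N}=\lambda_s .$$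
   Context: An ergodic fibred system consists of a transformation $T$ mapping a set $\Omega$ to itself, a measure $\mu$ on $\Omega$ that is finite and $T$-invariant, a digit set $\mathcal{D}\subset\mathbb{N}$, and a countable collection of disjoint (measurable) subsets $\{I_d\}_{d\in\mathcal{D}}$ of $\Omega$ such that $\mu$-almost every point of $\Omega$ lies in some $I_d$. The map $T$ is injective on each $I_d$, and $T$ is ergodic with respect to $\mu$. The $T$-expansion of a point $x\in\Omega$ is $x=[d_1,d_2,d_3,\dots]$, where $d_n$ is defined by $T^{n-1}x\in I_{d_n}$. For a string $s=[a_1,\dots,a_k]$ of digits from $\mathcal{D}$, the cylinder set is $C[s]=\{x=[d_1,d_2,\dots]\in\Omega \mid d_i=a_i,\ 1\le i\le k\}$, and $\lambda_s:=\mu(C[s])$; for a single digit $d$, $\lambda_d:=\mu(C[d])$. *)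

theory Defs
  imports "HOL-Analysis.Analysis"
begin

text \<open>
  The ambient set \<open>\<Omega>\<close> is \<^term>\<open>space M\<close>. The total mass is only required to be finite;
  it is not normalised to 1.
\<close>

locale ergodic_fibred_system = finite_measure M
  for M :: "'a measure" +
  fixes T :: "'a \<Rightarrow> 'a" and D :: "nat set" and I :: "nat \<Rightarrow> 'a set"
  assumes T_measurable: "T \<in> measurable M M"
    and T_invariant: "\<And>A. A \<in> sets M \<Longrightarrow> emeasure M (T -` A \<inter> space M) = emeasure M A"
    and I_measurable: "\<And>d. d \<in> D \<Longrightarrow> I d \<in> sets M"
    and I_disjoint: "disjoint_family_on I D"
    and I_cover: "AE x in M. \<exists>d\<in>D. x \<in> I d"
    and T_inj: "\<And>d. d \<in> D \<Longrightarrow> inj_on T (I d)"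
    and T_ergodic: "\<And>A. A \<in> sets M \<Longrightarrow> T -` A \<inter> space M = A
                      \<Longrightarrow> emeasure M A = 0 \<or> emeasure M (space M - A) = 0"

text \<open>
  Digit sequences are indexed from 0, so \<open>d n\<close> is the digit written \<open>d\<^sub>n\<^sub>+\<^sub>1\<close> in
  \<open>x = [d\<^sub>1, d\<^sub>2, \<dots>]\<close>. A point whose orbit leaves the union of the \<open>I d\<close> has no expansion.
\<close>

definition has_expansion ::
  "('a \<Rightarrow> 'a) \<Rightarrow> nat set \<Rightarrow> (nat \<Rightarrow> 'a set) \<Rightarrow> 'a \<Rightarrow> (nat \<Rightarrow> nat) \<Rightarrow> bool" where
  "has_expansion T D I x d \<longleftrightarrow> (\<forall>n. d n \<in> D \<and> (T ^^ n) x \<in> I (d n))"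

definition cylinder ::
  "'a measure \<Rightarrow> ('a \<Rightarrow> 'a) \<Rightarrow> nat set \<Rightarrow> (nat \<Rightarrow> 'a set) \<Rightarrow> nat list \<Rightarrow> 'a set" where
  "cylinder M T D I s =
     {x \<in> space M. \<exists>d. has_expansion T D I x d \<and> (\<forall>i<length s. d i = s ! i)}"

definition cyl_measure ::
  "'a measure \<Rightarrow> ('a \<Rightarrow> 'a) \<Rightarrow> nat set \<Rightarrow> (nat \<Rightarrow> 'a set) \<Rightarrow> nat list \<Rightarrow> real" where
  "cyl_measure M T D I s = measure M (cylinder M T D I s)"

definition digit_strings :: "nat set \<Rightarrow> nat list set" where
  "digit_strings D = {s. s \<noteq> [] \<and> set s \<subseteq> D}"

text \<open>
  If all strings \<open>S i\<close> are non-empty, then \<open>S 0, \<dots>, S n\<close> together have at least \<open>n + 1\<close>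
  digits, so the list indexing below is in range.
\<close>

definition concat_digits :: "(nat \<Rightarrow> nat list) \<Rightarrow> nat \<Rightarrow> nat" where
  "concat_digits S n = concat (map S [0..<Suc n]) ! n"

text \<open>
  Normality is a property of a digit sequence; the sequence need not be the expansion of a point.
  The condition \<open>n + length s \<le> N\<close> is \<open>0 \<le> n \<le> N - k\<close> without truncated subtraction.
\<close>

definition T_normal ::
  "'a measure \<Rightarrow> ('a \<Rightarrow> 'a) \<Rightarrow> nat set \<Rightarrow> (nat \<Rightarrow> 'a set) \<Rightarrow> (nat \<Rightarrow> nat) \<Rightarrow> bool" where
  "T_normal M T D I d \<longleftrightarrow>
     (\<forall>s\<in>digit_strings D.
        (\<lambda>N. real (card {n. n + length s \<le> N \<and> (\<forall>i<length s. d (n + i) = s ! i)}) / real N)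
          \<longlonglongrightarrow> cyl_measure M T D I s)"

end

theory Submission
  imports Defs
begin

text \<open>
  Write \<open>p d\<close> for the measure of the cylinder of the single digit \<open>d\<close>, and \<open>w\<close> for the product
  weight it induces on words. Summing the two-sided bounds over all words of length \<open>n\<close> shows that
  the powers of \<open>\<Sum>d. p d\<close> stay bounded away from 0 and from infinity, so \<open>p\<close> is a probability
  vector (\<open>bounds_imp_sum_eq_1\<close>) and \<open>w\<close> is the law of independent digits.

  Under \<open>w\<close>, the number of occurrences of a fixed pattern \<open>s\<close> in a word \<open>u\<close> is close to
  \<open>w s * length u\<close>, except for words of length \<open>n\<close> whose total weight decays exponentially in \<open>n\<close>.
  This comes from an exponential moment: occurrence counts are additive under concatenation up to a
  bounded error at the junction, so the moment is almost submultiplicative, and at a long enough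
  block length it is below 1 for a small positive parameter (\<open>exponential_tail\<close>,
  \<open>summable_deviant_weight\<close>).

  The cylinder measure is a shift-invariant weight bounded by a multiple of \<open>w\<close>. Hence the
  deviant words are negligible for it too; but by invariance its expected number of occurrences of
  \<open>s\<close> is governed by the measure of the cylinder of \<open>s\<close>. So that measure is exactly \<open>w s\<close>
  (\<open>consistent_weight_unique\<close>), and the strings are enumerated by decreasing product weight.

  Now cut the concatenation inside the string \<open>S n\<close>, and let \<open>t = w (S n)\<close>. All strings of weight
  above \<open>t\<close> come before \<open>S n\<close>, and their number is at least of order \<open>1 / t\<close>
  (\<open>heavy_words_lower_bound\<close>). All strings before the cut have weight at least \<open>t\<close>, so the deviant
  ones among them have total length at most \<open>K / t\<close> with \<open>K\<close> a convergent sum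
  (\<open>deviant_length_bound\<close>), which is a bounded multiple of \<open>n\<close>. The junctions contribute
  another bounded multiple of \<open>n\<close>, and the string that is cut has length at most of order \<open>log n\<close>. All
  this is negligible, because the lengths of the strings tend to infinity and the prefix is therefore
  much longer than \<open>n\<close>. The remaining strings have the right frequency, which proves
  \<open>enumeration_frequency\<close>. If there is only one digit the lengths of the strings can grow
  arbitrarily fast, but the sequence is constant (\<open>one_digit_frequency\<close>).
\<close>

section \<open>Words and occurrences of a pattern\<close>

definition words :: "nat set \<Rightarrow> nat \<Rightarrow> nat list set" where
  "words D n = {u. set u \<subseteq> D \<and> length u = n}"

lemma words_0 [simp]: "words D 0 = {[]}"
  by (auto simp: words_def)

lemma finite_words: "finite D \<Longrightarrow> finite (words D n)"
  unfolding words_def by (rule finite_lists_length_eq)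

lemma sum_words_append:
  fixes f :: "nat list \<Rightarrow> real"
  shows "(\<Sum>u\<in>words D (m + n). f u) = (\<Sum>u\<in>words D m. \<Sum>v\<in>words D n. f (u @ v))"
proof -
  have "bij_betw (\<lambda>(u, v). u @ v) (words D m \<times> words D n) (words D (m + n))"
  proof (rule bij_betw_byWitness[where f' = "\<lambda>u. (take m u, drop m u)"])
    show "(\<lambda>u. (take m u, drop m u)) ` words D (m + n) \<subseteq> words D m \<times> words D n"
      using set_take_subset set_drop_subset by (fastforce simp: words_def)
  qed (auto simp: words_def)
  then have "(\<Sum>u\<in>words D (m + n). f u)
      = (\<Sum>x\<in>words D m \<times> words D n. f ((\<lambda>(u, v). u @ v) x))"
    by (simp only: sum.reindex_bij_betw)
  also have "\<dots> = (\<Sum>(u, v)\<in>words D m \<times> words D n. f (u @ v))"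
    by (rule sum.cong) auto
  finally show ?thesis by (simp add: sum.cartesian_product)
qed

lemma sum_words_1:
  fixes f :: "nat list \<Rightarrow> real"
  shows "(\<Sum>u\<in>words D (Suc 0). f u) = (\<Sum>d\<in>D. f [d])"
proof -
  have "words D (Suc 0) = (\<lambda>d. [d]) ` D"
    by (auto simp: words_def length_Suc_conv)
  then show ?thesis by (simp add: sum.reindex inj_on_def)
qed

lemma sum_words_prefix:
  fixes \<nu> :: "nat list \<Rightarrow> real"
  assumes left: "\<And>v. set v \<subseteq> D \<Longrightarrow> (\<Sum>d\<in>D. \<nu> (d # v)) = \<nu> v" and v: "set v \<subseteq> D"
  shows "(\<Sum>u\<in>words D n. \<nu> (u @ v)) = \<nu> v"
proof (induction n)
  case (Suc n)
  have "(\<Sum>u\<in>words D (Suc n). \<nu> (u @ v)) = (\<Sum>d\<in>D. \<Sum>u\<in>words D n. \<nu> (d # u @ v))"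
    using sum_words_append[of "\<lambda>u. \<nu> (u @ v)" D "Suc 0" n] sum_words_1[of _ D] by simp
  also have "\<dots> = (\<Sum>u\<in>words D n. \<Sum>d\<in>D. \<nu> (d # u @ v))"
    by (rule sum.swap)
  also have "\<dots> = (\<Sum>u\<in>words D n. \<nu> (u @ v))"
    using v by (intro sum.cong refl left) (auto simp: words_def)
  finally show ?case using Suc.IH by simp
qed simp

lemma sum_words_suffix:
  fixes \<nu> :: "nat list \<Rightarrow> real"
  assumes right: "\<And>v. set v \<subseteq> D \<Longrightarrow> (\<Sum>d\<in>D. \<nu> (v @ [d])) = \<nu> v" and v: "set v \<subseteq> D"
  shows "(\<Sum>u\<in>words D n. \<nu> (v @ u)) = \<nu> v"
proof (induction n)
  case (Suc n)
  have "(\<Sum>u\<in>words D (Suc n). \<nu> (v @ u)) = (\<Sum>u\<in>words D n. \<Sum>d\<in>D. \<nu> ((v @ u) @ [d]))"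
    using sum_words_append[of "\<lambda>u. \<nu> (v @ u)" D n "Suc 0"] sum_words_1[of _ D] by simp
  also have "\<dots> = (\<Sum>u\<in>words D n. \<nu> (v @ u))"
    using v by (intro sum.cong refl right) (auto simp: words_def)
  finally show ?case using Suc.IH by simp
qed simp

definition occ :: "nat list \<Rightarrow> nat list \<Rightarrow> nat" where
  "occ s u = card {n. n + length s \<le> length u \<and> (\<forall>i<length s. u ! (n + i) = s ! i)}"

lemma finite_occ_set: "finite {n. n + length s \<le> length u \<and> P n}"
  by (rule finite_subset[of _ "{..length u}"]) auto

lemma occ_le_length:
  assumes "s \<noteq> []" shows "occ s u \<le> length u"
proof -
  have "occ s u \<le> card {..<length u}"
    unfolding occ_def using assms by (intro card_mono) (auto simp: Suc_le_eq neq_Nil_conv)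
  then show ?thesis by simp
qed

text \<open>An occurrence that straddles the junction starts at one of the last \<open>length s\<close> positions of \<open>u\<close>.\<close>

lemma occ_append_le: "occ s (u @ v) \<le> occ s u + occ s v + length s"
proof -
  let ?P = "\<lambda>u n. n + length s \<le> length u \<and> (\<forall>i<length s. u ! (n + i) = s ! i)"
  let ?Z = "{length u - length s..<length u}"
  have "{n. ?P (u @ v) n} \<subseteq> {n. ?P u n} \<union> (\<lambda>n. length u + n) ` {n. ?P v n} \<union> ?Z"
  proof
    fix n assume n: "n \<in> {n. ?P (u @ v) n}"
    consider "n + length s \<le> length u" | "n + length s > length u" "n < length u" | "n \<ge> length u"
      by linarith
    then show "n \<in> {n. ?P u n} \<union> (\<lambda>n. length u + n) ` {n. ?P v n} \<union> ?Z"
    proof cases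
      case 1
      then have "?P u n" using n by (auto simp: nth_append)
      then show ?thesis by blast
    next
      case 2 then show ?thesis by auto
    next
      case 3
      then have "?P v (n - length u)" using n by (auto simp: nth_append)
      moreover have "n = length u + (n - length u)" using 3 by simp
      ultimately show ?thesis by blast
    qed
  qed
  then have "occ s (u @ v) \<le> card ({n. ?P u n} \<union> (\<lambda>n. length u + n) ` {n. ?P v n} \<union> ?Z)"
    unfolding occ_def by (intro card_mono) (simp_all add: finite_occ_set)
  also have "\<dots> \<le> card {n. ?P u n} + card ((\<lambda>n. length u + n) ` {n. ?P v n}) + card ?Z"
    by (meson add_mono card_Un_le le_refl order_trans)
  also have "\<dots> \<le> occ s u + occ s v + length s"
    unfolding occ_def by (intro add_mono card_image_le finite_occ_set order_refl) simp
  finally show ?thesis .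
qed

lemma occ_append_ge:
  assumes "s \<noteq> []" shows "occ s u + occ s v \<le> occ s (u @ v)"
proof -
  let ?P = "\<lambda>u n. n + length s \<le> length u \<and> (\<forall>i<length s. u ! (n + i) = s ! i)"
  have "occ s u + occ s v = card {n. ?P u n} + card ((\<lambda>n. length u + n) ` {n. ?P v n})"
    unfolding occ_def by (subst card_image) (auto simp: inj_on_def)
  also have "\<dots> = card ({n. ?P u n} \<union> (\<lambda>n. length u + n) ` {n. ?P v n})"
    using assms by (intro card_Un_disjoint[symmetric] finite_imageI finite_occ_set)
      (auto simp: neq_Nil_conv)
  also have "\<dots> \<le> occ s (u @ v)"
    unfolding occ_def by (intro card_mono finite_occ_set) (auto simp: nth_append)
  finally show ?thesis .
qed

lemma match_iff_take_drop:
  assumes "n + length s \<le> length u"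
  shows "(\<forall>i<length s. u ! (n + i) = s ! i) \<longleftrightarrow> take (length s) (drop n u) = s"
  using assms by (auto simp: list_eq_iff_nth_eq)

text \<open>
  The two marginal conditions say that \<open>\<nu>\<close> is the family of finite-dimensional laws of a stationary
  sequence: each of the \<open>n + 1 - length s\<close> possible positions of \<open>s\<close> has expectation \<open>\<nu> s\<close>, as the
  digits on both sides of it can be summed out.
\<close>

lemma expected_occ:
  fixes \<nu> :: "nat list \<Rightarrow> real"
  assumes fin: "finite D"
    and left: "\<And>v. set v \<subseteq> D \<Longrightarrow> (\<Sum>d\<in>D. \<nu> (d # v)) = \<nu> v"
    and right: "\<And>v. set v \<subseteq> D \<Longrightarrow> (\<Sum>d\<in>D. \<nu> (v @ [d])) = \<nu> v"
    and s: "set s \<subseteq> D" and n: "length s \<le> n"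
  shows "(\<Sum>u\<in>words D n. \<nu> u * real (occ s u)) = real (n + 1 - length s) * \<nu> s"
proof -
  let ?k = "length s"
  let ?hit = "\<lambda>m u. if take ?k (drop m u) = s then 1 else 0 :: real"
  have occ: "real (occ s u) = (\<Sum>m<n + 1 - ?k. ?hit m u)" if "u \<in> words D n" for u
  proof -
    have "{m. m + ?k \<le> length u \<and> (\<forall>i<?k. u ! (m + i) = s ! i)}
        = {m \<in> {..<n + 1 - ?k}. take ?k (drop m u) = s}"
    proof (intro Collect_cong)
      fix m
      have len: "m + ?k \<le> length u \<longleftrightarrow> m \<in> {..<n + 1 - ?k}"
        using that n by (auto simp: words_def)
      show "(m + ?k \<le> length u \<and> (\<forall>i<?k. u ! (m + i) = s ! i))
          \<longleftrightarrow> (m \<in> {..<n + 1 - ?k} \<and> take ?k (drop m u) = s)"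
        by (metis len match_iff_take_drop)
    qed
    then show ?thesis by (simp add: occ_def sum.If_cases Int_def)
  qed
  have pos: "(\<Sum>u\<in>words D n. \<nu> u * ?hit m u) = \<nu> s" if m: "m < n + 1 - ?k" for m
  proof -
    define l where "l = n - ?k - m"
    have "n = m + (?k + l)" using m n by (simp add: l_def)
    then have "(\<Sum>u\<in>words D n. \<nu> u * ?hit m u)
        = (\<Sum>a\<in>words D m. \<Sum>b\<in>words D ?k. \<Sum>c\<in>words D l. \<nu> (a @ b @ c) * ?hit m (a @ b @ c))"
      by (simp only: sum_words_append)
    also have "\<dots> = (\<Sum>a\<in>words D m. \<Sum>b\<in>words D ?k. if b = s then \<Sum>c\<in>words D l. \<nu> (a @ b @ c) else 0)"
      by (intro sum.cong refl) (auto simp: words_def)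
    also have "\<dots> = (\<Sum>a\<in>words D m. \<Sum>c\<in>words D l. \<nu> ((a @ s) @ c))"
      using s by (simp add: sum.delta finite_words[OF fin]) (simp add: words_def)
    also have "\<dots> = (\<Sum>a\<in>words D m. \<nu> (a @ s))"
      using s by (intro sum.cong refl sum_words_suffix right) (auto simp: words_def)
    also have "\<dots> = \<nu> s" by (rule sum_words_prefix[OF left s])
    finally show ?thesis .
  qed
  have "(\<Sum>u\<in>words D n. \<nu> u * real (occ s u))
      = (\<Sum>u\<in>words D n. \<Sum>m<n + 1 - ?k. \<nu> u * ?hit m u)"
    by (intro sum.cong refl) (simp only: occ sum_distrib_left)
  also have "\<dots> = (\<Sum>m<n + 1 - ?k. \<Sum>u\<in>words D n. \<nu> u * ?hit m u)"
    by (rule sum.swap)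
  also have "\<dots> = (\<Sum>m<n + 1 - ?k. \<nu> s)"
    by (intro sum.cong refl pos) simp
  finally show ?thesis by simp
qed

section \<open>Product weights and concentration\<close>

definition weight :: "(nat \<Rightarrow> real) \<Rightarrow> nat list \<Rightarrow> real" where
  "weight p u = prod_list (map p u)"

lemma weight_simps [simp]:
  "weight p [] = 1" "weight p (d # u) = p d * weight p u"
  "weight p (u @ v) = weight p u * weight p v"
  by (simp_all add: weight_def)

lemma weight_eq_prod: "weight p s = (\<Prod>i<length s. p (s ! i))"
  by (induction s) (simp_all add: prod.lessThan_Suc_shift del: prod.lessThan_Suc)

lemma sum_weight_words: "(\<Sum>u\<in>words D n. weight p u) = (\<Sum>d\<in>D. p d) ^ n"
proof (induction n)
  case (Suc n)
  have "(\<Sum>u\<in>words D (Suc 0 + n). weight p u) = (\<Sum>d\<in>D. p d) * (\<Sum>u\<in>words D n. weight p u)"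
    by (simp only: sum_words_append sum_words_1 sum_product) simp
  with Suc show ?case by simp
qed simp

text \<open>
  The rate is the \<open>B\<close>-th root of \<open>\<rho>\<close>; the constant takes care of the residues modulo \<open>B\<close>.
\<close>

lemma geometric_bound_of_step:
  fixes g :: "nat \<Rightarrow> real"
  assumes B: "0 < B" and \<rho>: "0 < \<rho>" "\<rho> < 1"
    and g: "\<And>n. 0 \<le> g n" and step: "\<And>n. g (B + n) \<le> \<rho> * g n"
  shows "\<exists>C \<sigma>. 0 \<le> \<sigma> \<and> \<sigma> < 1 \<and> (\<forall>n. g n \<le> C * \<sigma> ^ n)"
proof -
  define \<sigma> where "\<sigma> = root B \<rho>"
  have \<sigma>: "0 < \<sigma>" "\<sigma> < 1" "\<sigma> ^ B = \<rho>"
    using B \<rho> by (auto simp: \<sigma>_def real_root_gt_zero)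
  define C where "C = (\<Sum>i<B. g i / \<sigma> ^ i)"
  have "g n \<le> C * \<sigma> ^ n" for n
  proof (induction n rule: less_induct)
    case (less n)
    show ?case
    proof (cases "n < B")
      case True
      have "g n / \<sigma> ^ n \<le> C"
        unfolding C_def using True g \<sigma> by (intro member_le_sum) auto
      then show ?thesis using \<sigma> by (simp add: field_simps)
    next
      case False
      then have n: "n = B + (n - B)" by simp
      have "g n \<le> \<rho> * g (n - B)" using step[of "n - B"] n by simp
      also have "\<dots> \<le> \<rho> * (C * \<sigma> ^ (n - B))"
        using less[of "n - B"] False B \<rho> by simp
      also have "\<dots> = C * \<sigma> ^ (B + (n - B))" by (simp add: power_add \<sigma>)
      finally show ?thesis using n by simp
    qed
  qed
  with \<sigma> show ?thesis by (intro exI[of _ C] exI[of _ \<sigma>]) auto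
qed

locale digit_weights =
  fixes D :: "nat set" and p :: "nat \<Rightarrow> real"
  assumes finite_D: "finite D" and p_pos: "\<And>d. d \<in> D \<Longrightarrow> 0 < p d"
    and sum_p: "(\<Sum>d\<in>D. p d) = 1"
begin

abbreviation w :: "nat list \<Rightarrow> real" where "w \<equiv> weight p"

lemma weight_pos: "set u \<subseteq> D \<Longrightarrow> 0 < w u"
  by (induction u) (auto simp: p_pos)

lemma sum_weight_1: "(\<Sum>u\<in>words D n. w u) = 1"
  by (simp add: sum_weight_words sum_p)

lemma weight_left: "(\<Sum>d\<in>D. w (d # v)) = w v"
  by (simp add: sum_distrib_right[symmetric] sum_p)

lemma weight_right: "(\<Sum>d\<in>D. w (v @ [d])) = w v"
  by (simp add: sum_distrib_left[symmetric] sum_p)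

lemma p_le_1: "d \<in> D \<Longrightarrow> p d \<le> 1"
  using member_le_sum[of d D p] finite_D p_pos sum_p by (auto intro: less_imp_le)

lemma weight_le_1: "set u \<subseteq> D \<Longrightarrow> w u \<le> 1"
proof (induction u)
  case (Cons d u)
  then show ?case using p_le_1[of d] p_pos[of d] weight_pos[of u] by (simp add: mult_le_one)
qed simp

text \<open>
  Cramer's method for a functional that is subadditive up to a constant. The function
  \<open>h \<theta>\<close>, the expectation of \<open>exp (\<theta> * (f u + K))\<close> over words of length \<open>B\<close>, has the value 1 and a
  negative derivative at 0, so it is below 1 for some \<open>\<theta> > 0\<close>. Prepending a block of length \<open>B\<close>
  multiplies the expectation of \<open>exp (\<theta> * f u)\<close> by at most \<open>h \<theta>\<close>, and Markov's inequality finishes.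
\<close>

lemma exponential_tail:
  fixes f :: "nat list \<Rightarrow> real"
  assumes sub: "\<And>u v. f (u @ v) \<le> f u + f v + K"
    and drift: "(\<Sum>u\<in>words D B. w u * f u) < - K"
  shows "\<exists>C \<sigma>. 0 \<le> \<sigma> \<and> \<sigma> < 1 \<and> (\<forall>n. (\<Sum>u\<in>{u \<in> words D n. 0 \<le> f u}. w u) \<le> C * \<sigma> ^ n)"
proof -
  have fin: "finite (words D n)" for n by (rule finite_words[OF finite_D])
  have wpos: "0 < w u" if "u \<in> words D n" for u n
    using that by (intro weight_pos) (auto simp: words_def)
  \<comment> \<open>Subadditivity at the empty word gives \<open>f [] \<ge> - K\<close>, which excludes \<open>B = 0\<close>.\<close>
  have B: "0 < B"
    using sub[of "[]" "[]"] drift by (cases B) auto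
  define h where "h \<theta> = (\<Sum>u\<in>words D B. w u * exp (\<theta> * (f u + K)))" for \<theta> :: real
  have "(h has_real_derivative (\<Sum>u\<in>words D B. w u * (f u + K))) (at 0)"
    unfolding h_def by (auto intro!: derivative_eq_intros simp: mult_ac)
  moreover have "(\<Sum>u\<in>words D B. w u * (f u + K)) < 0"
    using drift sum_weight_1[of B]
    by (simp add: distrib_left sum.distrib sum_distrib_right[symmetric])
  ultimately obtain \<delta> where \<delta>: "0 < \<delta>" "\<And>x. 0 < x \<Longrightarrow> x < \<delta> \<Longrightarrow> h (0 + x) < h 0"
    using DERIV_neg_dec_right by blast
  define \<theta> where "\<theta> = \<delta> / 2"
  have \<theta>: "0 < \<theta>" "h \<theta> < h 0" using \<delta> by (auto simp: \<theta>_def)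
  have "h 0 = 1" by (simp add: h_def sum_weight_1)
  have "words D B \<noteq> {}" using sum_weight_1[of B] by auto
  then have "0 < h \<theta>" unfolding h_def by (intro sum_pos fin) (auto simp: wpos)
  define g where "g n = (\<Sum>u\<in>words D n. w u * exp (\<theta> * f u))" for n
  have "g (B + n) \<le> h \<theta> * g n" for n
  proof -
    have "g (B + n) = (\<Sum>u\<in>words D B. \<Sum>v\<in>words D n. w (u @ v) * exp (\<theta> * f (u @ v)))"
      unfolding g_def by (rule sum_words_append)
    also have "\<dots> \<le> (\<Sum>u\<in>words D B. \<Sum>v\<in>words D n.
        (w u * exp (\<theta> * (f u + K))) * (w v * exp (\<theta> * f v)))"
    proof (intro sum_mono)
      fix u v assume uv: "u \<in> words D B" "v \<in> words D n"
      have "exp (\<theta> * f (u @ v)) \<le> exp (\<theta> * (f u + K)) * exp (\<theta> * f v)"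
        using sub[of u v] \<theta> by (simp add: exp_add[symmetric] distrib_left[symmetric] add_ac)
      then have "(w u * w v) * exp (\<theta> * f (u @ v))
          \<le> (w u * w v) * (exp (\<theta> * (f u + K)) * exp (\<theta> * f v))"
        using wpos[OF uv(1)] wpos[OF uv(2)] by (intro mult_left_mono) auto
      then show "w (u @ v) * exp (\<theta> * f (u @ v))
          \<le> (w u * exp (\<theta> * (f u + K))) * (w v * exp (\<theta> * f v))"
        by (simp add: mult_ac)
    qed
    also have "\<dots> = h \<theta> * g n" by (simp add: h_def g_def sum_product)
    finally show ?thesis .
  qed
  moreover have "0 \<le> g n" for n
    unfolding g_def by (intro sum_nonneg) (simp add: wpos less_imp_le)
  ultimately obtain C \<sigma> where C: "0 \<le> \<sigma>" "\<sigma> < 1" "\<And>n. g n \<le> C * \<sigma> ^ n"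
    using geometric_bound_of_step[of B "h \<theta>" g] B \<open>0 < h \<theta>\<close> \<theta> \<open>h 0 = 1\<close> by auto
  have "(\<Sum>u\<in>{u \<in> words D n. 0 \<le> f u}. w u) \<le> g n" for n
  proof -
    have "(\<Sum>u\<in>{u \<in> words D n. 0 \<le> f u}. w u)
        \<le> (\<Sum>u\<in>{u \<in> words D n. 0 \<le> f u}. w u * exp (\<theta> * f u))"
      using \<theta> by (intro sum_mono) (auto simp: wpos less_imp_le)
    also have "\<dots> \<le> g n"
      unfolding g_def by (intro sum_mono2 fin) (auto simp: wpos less_imp_le)
    finally show ?thesis .
  qed
  with C show ?thesis by (meson order_trans)
qed

definition deviation :: "nat list \<Rightarrow> nat list \<Rightarrow> real" where
  "deviation s u = \<bar>real (occ s u) - w s * real (length u)\<bar>"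

lemma deviation_append:
  assumes "s \<noteq> []"
  shows "deviation s (u @ v) \<le> deviation s u + deviation s v + real (length s)"
proof -
  have "real (occ s (u @ v)) \<le> real (occ s u) + real (occ s v) + real (length s)"
    using occ_append_le[of s u v] by linarith
  moreover have "real (occ s u) + real (occ s v) \<le> real (occ s (u @ v))"
    using occ_append_ge[OF assms, of u v] by linarith
  ultimately show ?thesis
    unfolding deviation_def length_append of_nat_add distrib_left by linarith
qed

lemma deviation_le_length:
  assumes "s \<noteq> []" "set s \<subseteq> D"
  shows "deviation s u \<le> real (length u)"
proof -
  have "real (occ s u) \<le> real (length u)" using occ_le_length[OF assms(1)] by simp
  moreover have "w s * real (length u) \<le> 1 * real (length u)"
    using weight_le_1[OF assms(2)] by (intro mult_right_mono) auto
  moreover have "0 \<le> w s * real (length u)" using weight_pos[OF assms(2)] by simp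
  ultimately show ?thesis by (simp add: deviation_def abs_le_iff)
qed

text \<open>
  The upper and the lower deviation are both subadditive up to a constant, with error \<open>length s\<close> and 0
  respectively. Both have drift \<open>- \<epsilon>\<close> per digit, up to the boundary effect of fewer than
  \<open>length s\<close> missing positions, so a block length \<open>B\<close> with \<open>\<epsilon> * B > length s\<close> is long enough for
  the exponential tail bound. The factor \<open>n\<close> is what the estimate of total lengths needs.
\<close>

lemma summable_deviant_weight:
  assumes s: "s \<noteq> []" "set s \<subseteq> D" and \<epsilon>: "0 < \<epsilon>"
  shows "summable (\<lambda>n. real n * (\<Sum>u\<in>{u \<in> words D n. \<epsilon> * real (length u) \<le> deviation s u}. w u))"
proof -
  let ?k = "real (length s)"
  have fin: "finite (words D n)" for n by (rule finite_words[OF finite_D])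
  have wpos: "0 \<le> w u" if "u \<in> words D n" for u n
    using that weight_pos[of u] by (simp add: words_def)
  define f1 where "f1 u = real (occ s u) - (w s + \<epsilon>) * real (length u)" for u
  define f2 where "f2 u = (w s - \<epsilon>) * real (length u) - real (occ s u)" for u
  obtain B0 :: nat where B0: "?k / \<epsilon> < real B0" using reals_Archimedean2 by blast
  define B where "B = B0 + length s"
  have B: "?k < \<epsilon> * real B" "length s \<le> B"
    using B0 \<epsilon> by (auto simp: B_def field_simps add_pos_nonneg intro: less_le_trans)
  have ws: "0 < w s" "w s \<le> 1" using s weight_pos weight_le_1 by auto
  have E: "(\<Sum>u\<in>words D B. w u * real (occ s u)) = (real B + 1 - ?k) * w s"
    using expected_occ[OF finite_D weight_left weight_right s(2) B(2)] B(2) by (simp add: of_nat_diff)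
  have L: "(\<Sum>u\<in>words D B. w u * (c * real (length u))) = c * real B" for c
  proof -
    have "(\<Sum>u\<in>words D B. w u * (c * real (length u))) = (\<Sum>u\<in>words D B. w u * (c * real B))"
      by (rule sum.cong) (auto simp: words_def)
    then show ?thesis by (simp add: sum_distrib_right[symmetric] sum_weight_1)
  qed
  have k1: "1 \<le> ?k" using s(1) by (cases s) auto
  have "f1 (u @ v) \<le> f1 u + f1 v + ?k" for u v
    using occ_append_le[of s u v] unfolding f1_def by (simp add: distrib_left)
  moreover have "(\<Sum>u\<in>words D B. w u * f1 u) < - ?k"
  proof -
    have "(\<Sum>u\<in>words D B. w u * f1 u) = (real B + 1 - ?k) * w s - (w s + \<epsilon>) * real B"
      unfolding f1_def by (simp only: right_diff_distrib sum_subtractf E L)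
    also have "\<dots> = (1 - ?k) * w s - \<epsilon> * real B" by (simp add: algebra_simps)
    also have "\<dots> < - ?k" using mult_nonpos_nonneg[of "1 - ?k" "w s"] k1 ws B(1) by linarith
    finally show ?thesis .
  qed
  ultimately have "\<exists>C \<sigma>. 0 \<le> \<sigma> \<and> \<sigma> < 1 \<and>
      (\<forall>n. (\<Sum>u\<in>{u \<in> words D n. 0 \<le> f1 u}. w u) \<le> C * \<sigma> ^ n)"
    by (rule exponential_tail)
  then obtain C1 \<sigma>1 where 1: "0 \<le> \<sigma>1" "\<sigma>1 < 1"
    "\<And>n. (\<Sum>u\<in>{u \<in> words D n. 0 \<le> f1 u}. w u) \<le> C1 * \<sigma>1 ^ n"
    by blast
  have "f2 (u @ v) \<le> f2 u + f2 v + 0" for u v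
    using occ_append_ge[OF s(1), of u v] unfolding f2_def by (simp add: distrib_left)
  moreover have "(\<Sum>u\<in>words D B. w u * f2 u) < - 0"
  proof -
    have "(\<Sum>u\<in>words D B. w u * f2 u) = (w s - \<epsilon>) * real B - (real B + 1 - ?k) * w s"
      unfolding f2_def by (simp only: right_diff_distrib sum_subtractf E L)
    also have "\<dots> = (?k - 1) * w s - \<epsilon> * real B" by (simp add: algebra_simps)
    also have "\<dots> < 0" using mult_left_le[of "w s" "?k - 1"] k1 ws B(1) by linarith
    finally show ?thesis by simp
  qed
  ultimately have "\<exists>C \<sigma>. 0 \<le> \<sigma> \<and> \<sigma> < 1 \<and>
      (\<forall>n. (\<Sum>u\<in>{u \<in> words D n. 0 \<le> f2 u}. w u) \<le> C * \<sigma> ^ n)"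
    by (rule exponential_tail)
  then obtain C2 \<sigma>2 where 2: "0 \<le> \<sigma>2" "\<sigma>2 < 1"
    "\<And>n. (\<Sum>u\<in>{u \<in> words D n. 0 \<le> f2 u}. w u) \<le> C2 * \<sigma>2 ^ n"
    by blast
  have bound: "(\<Sum>u\<in>{u \<in> words D n. \<epsilon> * real (length u) \<le> deviation s u}. w u)
      \<le> C1 * \<sigma>1 ^ n + C2 * \<sigma>2 ^ n" for n
  proof -
    have "(\<Sum>u\<in>{u \<in> words D n. \<epsilon> * real (length u) \<le> deviation s u}. w u)
        \<le> (\<Sum>u\<in>{u \<in> words D n. 0 \<le> f1 u} \<union> {u \<in> words D n. 0 \<le> f2 u}. w u)"
      using fin wpos
      by (intro sum_mono2) (auto simp: deviation_def f1_def f2_def algebra_simps abs_if split: if_splits)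
    also have "\<dots> \<le> (\<Sum>u\<in>{u \<in> words D n. 0 \<le> f1 u}. w u) + (\<Sum>u\<in>{u \<in> words D n. 0 \<le> f2 u}. w u)"
      using fin wpos by (subst sum_Un) (auto intro!: sum_nonneg)
    finally show ?thesis using 1(3)[of n] 2(3)[of n] by linarith
  qed
  have geo: "summable (\<lambda>n. real n * \<sigma> ^ n)" if "0 \<le> \<sigma>" "\<sigma> < 1" for \<sigma> :: real
  proof (rule summable_comparison_test)
    show "summable (\<lambda>n. real (Suc n) * \<sigma> ^ n)"
      using geometric_deriv_sums[of \<sigma>] that sums_summable by force
    show "\<exists>N. \<forall>n\<ge>N. norm (real n * \<sigma> ^ n) \<le> real (Suc n) * \<sigma> ^ n"
      using that by (auto intro!: mult_right_mono)
  qed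
  show ?thesis
  proof (rule summable_comparison_test)
    show "summable (\<lambda>n. C1 * (real n * \<sigma>1 ^ n) + C2 * (real n * \<sigma>2 ^ n))"
      using 1 2 by (intro summable_add summable_mult geo) auto
    have "norm (real n * (\<Sum>u\<in>{u \<in> words D n. \<epsilon> * real (length u) \<le> deviation s u}. w u))
        \<le> C1 * (real n * \<sigma>1 ^ n) + C2 * (real n * \<sigma>2 ^ n)" for n
    proof -
      have "0 \<le> (\<Sum>u\<in>{u \<in> words D n. \<epsilon> * real (length u) \<le> deviation s u}. w u)"
        using wpos by (intro sum_nonneg) auto
      then have "norm (real n * (\<Sum>u\<in>{u \<in> words D n. \<epsilon> * real (length u) \<le> deviation s u}. w u))
          \<le> real n * (C1 * \<sigma>1 ^ n + C2 * \<sigma>2 ^ n)"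
        using mult_left_mono[OF bound[of n], of "real n"] by simp
      then show ?thesis by (simp add: algebra_simps)
    qed
    then show "\<exists>N. \<forall>n\<ge>N. norm (real n * (\<Sum>u\<in>{u \<in> words D n. \<epsilon> * real (length u) \<le> deviation s u}. w u))
        \<le> C1 * (real n * \<sigma>1 ^ n) + C2 * (real n * \<sigma>2 ^ n)" by blast
  qed
qed

text \<open>
  A shift-invariant measure absolutely continuous with respect to a Bernoulli measure equals it.
  The expected number of occurrences of \<open>s\<close> in a random word of length \<open>n\<close> under \<open>\<nu>\<close> is about
  \<open>n * \<nu> s\<close> by stationarity, and about \<open>n * w s\<close> because words with another frequency have small
  \<open>w\<close>-weight and hence small \<open>\<nu>\<close>-weight.
\<close>

lemma consistent_weight_unique:
  assumes nonneg: "\<And>u. set u \<subseteq> D \<Longrightarrow> 0 \<le> \<nu> u" and total: "\<nu> [] = 1"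
    and left: "\<And>v. set v \<subseteq> D \<Longrightarrow> (\<Sum>d\<in>D. \<nu> (d # v)) = \<nu> v"
    and right: "\<And>v. set v \<subseteq> D \<Longrightarrow> (\<Sum>d\<in>D. \<nu> (v @ [d])) = \<nu> v"
    and dom: "\<And>u. u \<noteq> [] \<Longrightarrow> set u \<subseteq> D \<Longrightarrow> \<nu> u \<le> c * w u"
    and s: "s \<noteq> []" "set s \<subseteq> D"
  shows "\<nu> s = w s"
proof (rule ccontr)
  assume "\<nu> s \<noteq> w s"
  define \<delta> where "\<delta> = \<bar>\<nu> s - w s\<bar>"
  have \<delta>: "0 < \<delta> / 2" using \<open>\<nu> s \<noteq> w s\<close> by (simp add: \<delta>_def)
  define bad where "bad n = {u \<in> words D n. \<delta> / 2 * real (length u) \<le> deviation s u}" for n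
  have fin: "finite (words D n)" for n by (rule finite_words[OF finite_D])
  have \<nu>0: "0 \<le> \<nu> u" if "u \<in> words D n" for u n
    using that nonneg[of u] by (simp add: words_def)
  have mass: "(\<Sum>u\<in>words D n. \<nu> u) = 1" for n
    using sum_words_prefix[of D \<nu> "[]" n] left total by simp
  have bound: "real n * (\<delta> / 2) \<le> real (length s) * \<nu> s + c * (real n * (\<Sum>u\<in>bad n. w u))"
    if n: "length s \<le> n" for n
  proof -
    have n0: "0 < n" using n s(1) by (cases s) auto
    have "(\<Sum>u\<in>words D n. \<nu> u * (real (occ s u) - w s * real n))
        = real (n + 1 - length s) * \<nu> s - w s * real n"
      using expected_occ[OF finite_D left right s(2) n]
      by (simp add: right_diff_distrib sum_subtractf sum_distrib_right[symmetric] mass)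
    then have "\<bar>real (n + 1 - length s) * \<nu> s - w s * real n\<bar>
        \<le> (\<Sum>u\<in>words D n. \<bar>\<nu> u * (real (occ s u) - w s * real n)\<bar>)"
      by (metis sum_abs)
    also have "\<dots> = (\<Sum>u\<in>words D n. \<nu> u * deviation s u)"
      by (rule sum.cong) (auto simp: deviation_def abs_mult \<nu>0, auto simp: words_def)
    also have "\<dots> \<le> (\<Sum>u\<in>words D n. \<delta> / 2 * real n * \<nu> u + (if u \<in> bad n then \<nu> u * real n else 0))"
    proof (rule sum_mono)
      fix u assume u: "u \<in> words D n"
      then have len: "length u = n" by (simp add: words_def)
      show "\<nu> u * deviation s u \<le> \<delta> / 2 * real n * \<nu> u + (if u \<in> bad n then \<nu> u * real n else 0)"
      proof (cases "u \<in> bad n")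
        case True
        have "\<nu> u * deviation s u \<le> \<nu> u * real n"
          using deviation_le_length[OF s, of u] len by (intro mult_left_mono \<nu>0[OF u]) auto
        moreover have "0 \<le> \<delta> / 2 * real n * \<nu> u" using \<delta> \<nu>0[OF u] by simp
        ultimately show ?thesis using True by simp
      next
        case False
        then have "deviation s u \<le> \<delta> / 2 * real n" using u len by (auto simp: bad_def)
        then have "\<nu> u * deviation s u \<le> \<nu> u * (\<delta> / 2 * real n)"
          by (intro mult_left_mono \<nu>0[OF u])
        then show ?thesis using False by (simp add: mult_ac)
      qed
    qed
    also have "\<dots> = \<delta> / 2 * real n + (\<Sum>u\<in>bad n. \<nu> u * real n)"
      by (simp only: sum.distrib sum_distrib_left[symmetric] mass sum.If_cases fin)
        (simp add: bad_def Int_def)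
    also have "(\<Sum>u\<in>bad n. \<nu> u * real n) \<le> (\<Sum>u\<in>bad n. c * w u * real n)"
      using n0 by (intro sum_mono mult_right_mono dom) (auto simp: bad_def words_def)
    also have "\<dots> = c * (real n * (\<Sum>u\<in>bad n. w u))"
      by (simp add: sum_distrib_left sum_distrib_right mult_ac)
    finally have "\<bar>real (n + 1 - length s) * \<nu> s - w s * real n\<bar>
        \<le> \<delta> / 2 * real n + c * (real n * (\<Sum>u\<in>bad n. w u))" by simp
    moreover have "real (n + 1 - length s) * \<nu> s - w s * real n
        = (\<nu> s - w s) * real n - (real (length s) - 1) * \<nu> s"
      using n by (simp add: of_nat_diff algebra_simps)
    moreover have "\<bar>(\<nu> s - w s) * real n\<bar> = \<delta> * real n" by (simp add: \<delta>_def abs_mult)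
    moreover have "0 \<le> (real (length s) - 1) * \<nu> s" "(real (length s) - 1) * \<nu> s \<le> real (length s) * \<nu> s"
      using nonneg[OF s(2)] s(1) by (auto simp: neq_Nil_conv algebra_simps)
    ultimately show ?thesis by (simp add: mult.commute)
  qed
  have "(\<lambda>n. c * (real n * (\<Sum>u\<in>bad n. w u))) \<longlonglongrightarrow> c * 0"
    unfolding bad_def using summable_LIMSEQ_zero[OF summable_deviant_weight[OF s \<delta>]]
    by (rule tendsto_mult_left)
  then have "eventually (\<lambda>n. c * (real n * (\<Sum>u\<in>bad n. w u)) < 1) sequentially"
    by (rule order_tendstoD) simp
  moreover have "eventually (\<lambda>n. (real (length s) * \<nu> s + 1) / (\<delta> / 2) \<le> real n) sequentially"
    using filterlim_real_sequentially by (simp add: filterlim_at_top)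
  ultimately have "eventually (\<lambda>n. False) sequentially"
    using eventually_ge_at_top[of "length s"]
  proof eventually_elim
    case (elim n)
    then have "real (length s) * \<nu> s + 1 \<le> real n * (\<delta> / 2)" using \<delta> by (simp add: field_simps)
    then show ?case using bound[OF elim(3)] elim(1) by linarith
  qed
  then show False by simp
qed

section \<open>Counting heavy words\<close>

lemma weight_le_power:
  assumes "\<And>d. d \<in> D \<Longrightarrow> p d \<le> q" "0 \<le> q" "set u \<subseteq> D"
  shows "w u \<le> q ^ length u"
  using assms(3)
proof (induction u)
  case (Cons d u)
  then have "p d * w u \<le> q * q ^ length u"
    using assms(1,2) p_pos[of d] weight_pos[of u] by (intro mult_mono) auto
  then show ?case by simp
qed simp

text \<open>
  The heavy words form a tree rooted at the empty word, and almost surely a random infinite word leaves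
  it. It leaves at a child of a heavy word, each child outside the tree has weight at most \<open>t\<close>, and
  there are at most \<open>card D\<close> children for each heavy word. Level by level, the weight lost between
  length \<open>j\<close> and length \<open>j + 1\<close> is at most \<open>card D * t\<close> times the number of heavy words of length \<open>j\<close>.
\<close>

lemma heavy_words_lower_bound:
  assumes q: "\<And>d. d \<in> D \<Longrightarrow> p d \<le> q" "0 \<le> q" "q < 1" and t: "0 < t" "t < 1"
    and W: "finite W" "\<And>v. set v \<subseteq> D \<Longrightarrow> t < w v \<Longrightarrow> v \<in> W"
  shows "1 \<le> real (card D) * t * real (card W)"
proof -
  have fin: "finite (words D n)" for n by (rule finite_words[OF finite_D])
  have wpos: "0 < w u" if "u \<in> words D n" for u n
    using that weight_pos[of u] by (simp add: words_def)
  define H where "H j = {v \<in> words D j. t < w v}" for j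
  have finH: "finite (H j)" for j using fin by (simp add: H_def)
  let ?r = "real (card D)"
  let ?h = "\<lambda>u. if t < w u then w u else 0"
  have step: "(\<Sum>v\<in>H j. w v) \<le> ?r * t * real (card (H j)) + (\<Sum>v\<in>H (Suc j). w v)" for j
  proof -
    have "(\<Sum>v\<in>H j. w v) = (\<Sum>v\<in>H j. \<Sum>d\<in>D. w (v @ [d]))"
      by (simp only: weight_right)
    also have "\<dots> \<le> (\<Sum>v\<in>H j. \<Sum>d\<in>D. t + ?h (v @ [d]))"
      using t by (intro sum_mono) (auto simp del: weight_simps)
    also have "\<dots> = ?r * t * real (card (H j)) + (\<Sum>v\<in>H j. \<Sum>d\<in>D. ?h (v @ [d]))"
      by (simp add: sum.distrib del: weight_simps)
    also have "(\<Sum>v\<in>H j. \<Sum>d\<in>D. ?h (v @ [d])) \<le> (\<Sum>v\<in>words D j. \<Sum>d\<in>D. ?h (v @ [d]))"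
      using t by (intro sum_mono2 fin sum_nonneg) (auto simp: H_def simp del: weight_simps)
    also have "\<dots> = (\<Sum>v\<in>words D (j + Suc 0). ?h v)"
      by (simp only: sum_words_append sum_words_1)
    also have "\<dots> = (\<Sum>v\<in>H (Suc j). w v)"
      by (simp add: sum.If_cases fin H_def Int_def)
    finally show ?thesis by simp
  qed
  have telescope: "1 \<le> ?r * t * (\<Sum>j<L. real (card (H j))) + (\<Sum>v\<in>H L. w v)" for L
  proof (induction L)
    case 0
    have "H 0 = {[]}" using t by (auto simp: H_def)
    then show ?case by simp
  next
    case (Suc L)
    then show ?case using step[of L] by (simp add: distrib_left)
  qed
  obtain L where L: "q ^ L < t" using real_arch_pow_inv t(1) q(3) by blast
  have "H L = {}"
    using L weight_le_power[OF q(1,2)] by (fastforce simp: H_def words_def)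
  then have "1 \<le> ?r * t * (\<Sum>j<L. real (card (H j)))" using telescope[of L] by simp
  also have "(\<Sum>j<L. real (card (H j))) = real (card (\<Union>j<L. H j))"
    by (subst card_UN_disjoint) (auto simp: finH, auto simp: H_def words_def)
  also have "?r * t * real (card (\<Union>j<L. H j)) \<le> ?r * t * real (card W)"
    using t W by (intro mult_left_mono of_nat_mono card_mono) (auto simp: H_def words_def)
  finally show ?thesis .
qed

end

section \<open>Concatenations\<close>

definition concat_first :: "(nat \<Rightarrow> nat list) \<Rightarrow> nat \<Rightarrow> nat list" where
  "concat_first S n = concat (map S [0..<n])"

lemma concat_first_simps [simp]:
  "concat_first S 0 = []" "concat_first S (Suc n) = concat_first S n @ S n"
  by (simp_all add: concat_first_def)

lemma length_concat_first: "length (concat_first S n) = (\<Sum>i<n. length (S i))"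
  by (induction n) simp_all

lemma concat_first_add: "\<exists>v. concat_first S (m + n) = concat_first S m @ v"
  by (induction n) auto

lemma concat_first_long:
  assumes "\<And>i. S i \<noteq> []" shows "n \<le> length (concat_first S n)"
proof (induction n)
  case (Suc n)
  then show ?case using assms[of n] by (cases "S n") auto
qed simp

lemma concat_digits_nth:
  assumes ne: "\<And>i. S i \<noteq> []" and i: "i < length (concat_first S n)"
  shows "concat_digits S i = concat_first S n ! i"
proof -
  have eq: "concat_first S m ! i = concat_first S n ! i"
    if "i < length (concat_first S m)" "i < length (concat_first S n)" "m \<le> n" for m n
    using concat_first_add[of S m "n - m"] that by (auto simp: nth_append)
  have "i < length (concat_first S (Suc i))"
    using concat_first_long[of S "Suc i", OF ne] by simp
  then show ?thesis
    using eq[of "Suc i" n] eq[of n "Suc i"] i unfolding concat_digits_def concat_first_def[symmetric]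
    by (metis nat_le_linear)
qed

lemma map_concat_digits:
  assumes "\<And>i. S i \<noteq> []" "N \<le> length (concat_first S n)"
  shows "map (concat_digits S) [0..<N] = take N (concat_first S n)"
  using assms concat_digits_nth[of S _ n] by (intro nth_equalityI) auto

text \<open>
  The cut at \<open>N\<close> falls into the string number \<open>n\<close>, and \<open>n\<close> is as large as desired if \<open>N\<close> is.
\<close>

lemma containing_block:
  assumes ne: "\<And>i. S i \<noteq> []" and N: "length (concat_first S n0) \<le> N"
  shows "\<exists>n\<ge>n0. length (concat_first S n) \<le> N \<and> N < length (concat_first S (Suc n))"
proof -
  have ex: "N < length (concat_first S (Suc N))" using concat_first_long[of S "Suc N", OF ne] by simp
  define m where "m = (LEAST m. N < length (concat_first S m))"
  have m: "N < length (concat_first S m)" unfolding m_def using ex by (rule LeastI)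
  have "n0 < m"
  proof (rule ccontr)
    assume "\<not> n0 < m"
    then have "length (concat_first S m) \<le> length (concat_first S n0)"
      using concat_first_add[of S m "n0 - m"] by auto
    then show False using m N by simp
  qed
  then obtain n where n: "m = Suc n" "n0 \<le> n" by (cases m) auto
  have "\<not> N < length (concat_first S n)" using not_less_Least[of n "\<lambda>m. N < length (concat_first S m)"] n by (simp add: m_def)
  then show ?thesis using m n by (intro exI[of _ n]) auto
qed

section \<open>Enumerations by decreasing weight\<close>

context digit_weights
begin

lemma deviation_concat_first:
  assumes "s \<noteq> []"
  shows "deviation s (concat_first S n) \<le> (\<Sum>i<n. deviation s (S i)) + real n * real (length s)"
proof (induction n)
  case 0
  show ?case using occ_le_length[OF assms, of "[]"] by (simp add: deviation_def)
next
  case (Suc n)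
  then show ?case using deviation_append[OF assms, of "concat_first S n" "S n"]
    by (simp add: algebra_simps)
qed

text \<open>
  There is a single word of each length, so the expected number of occurrences is the actual one.
\<close>

lemma one_digit_frequency:
  assumes D: "D = {a}" and s: "s \<noteq> []" "set s \<subseteq> D" and d: "\<And>n. d n \<in> D"
  shows "(\<lambda>N. real (occ s (map d [0..<N])) / real N) \<longlonglongrightarrow> w s"
proof -
  have occ: "real (occ s (map d [0..<N])) = (real N + 1 - real (length s)) * w s"
    if N: "length s \<le> N" for N
  proof -
    let ?u = "map d [0..<N]"
    have d: "d n = a" for n using d[of n] D by simp
    have "u = ?u" if "u \<in> words D N" for u
    proof -
      have "u ! i = a" if "i < N" for i
      proof -
        have "u ! i \<in> set u" using \<open>u \<in> words D N\<close> that by (simp add: words_def)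
        then show ?thesis using \<open>u \<in> words D N\<close> D by (auto simp: words_def)
      qed
      then show ?thesis using that by (intro nth_equalityI) (auto simp: words_def d)
    qed
    moreover have "?u \<in> words D N" using D by (auto simp: words_def d)
    ultimately have wd: "words D N = {?u}" by blast
    have "w ?u = 1" using sum_weight_1[of N] by (simp add: wd)
    then show ?thesis
      using expected_occ[OF finite_D weight_left weight_right s(2) N] N by (simp add: wd of_nat_diff)
  qed
  have "(\<lambda>N. (real N + 1 - real (length s)) * w s / real N) \<longlonglongrightarrow> w s"
  proof -
    have "(\<lambda>N. w s + ((1 - real (length s)) * w s) * inverse (real N)) \<longlonglongrightarrow> w s + ((1 - real (length s)) * w s) * 0"
      by (intro tendsto_intros lim_inverse_n)
    moreover have "eventually (\<lambda>N. w s + ((1 - real (length s)) * w s) * inverse (real N)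
        = (real N + 1 - real (length s)) * w s / real N) sequentially"
      using eventually_gt_at_top[of 0] by eventually_elim (simp add: field_simps)
    ultimately show ?thesis by (simp add: Lim_transform_eventually)
  qed
  moreover have "eventually (\<lambda>N. (real N + 1 - real (length s)) * w s / real N
      = real (occ s (map d [0..<N])) / real N) sequentially"
    using eventually_ge_at_top[of "length s"] by eventually_elim (simp add: occ)
  ultimately show ?thesis by (rule Lim_transform_eventually)
qed

text \<open>
  For words of weight at least \<open>t\<close>, \<open>t\<close> times the length is at most the weight times the length, and the
  latter has a finite sum over all deviant words.
\<close>

lemma deviant_length_bound:
  assumes inj: "inj_on S A" and A: "finite A" "\<And>i. i \<in> A \<Longrightarrow> set (S i) \<subseteq> D"
    and t: "\<And>i. i \<in> A \<Longrightarrow> t \<le> w (S i)"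
    and dev: "\<And>i. i \<in> A \<Longrightarrow> \<epsilon> * real (length (S i)) \<le> deviation s (S i)"
    and s: "s \<noteq> []" "set s \<subseteq> D" and \<epsilon>: "0 < \<epsilon>"
  shows "t * (\<Sum>i\<in>A. real (length (S i)))
    \<le> (\<Sum>n. real n * (\<Sum>u\<in>{u \<in> words D n. \<epsilon> * real (length u) \<le> deviation s u}. w u))"
proof -
  define bad where "bad n = {u \<in> words D n. \<epsilon> * real (length u) \<le> deviation s u}" for n
  have fin: "finite (bad n)" for n using finite_words[OF finite_D] by (simp add: bad_def)
  have w0: "0 \<le> w u" if "u \<in> bad n" for u n
    using that weight_pos[of u] by (simp add: bad_def words_def)
  obtain J where J: "\<And>i. i \<in> A \<Longrightarrow> length (S i) < J"
    using finite_nat_set_iff_bounded[of "(length \<circ> S) ` A"] A(1) by auto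
  have "t * (\<Sum>i\<in>A. real (length (S i))) \<le> (\<Sum>i\<in>A. real (length (S i)) * w (S i))"
    unfolding sum_distrib_left by (intro sum_mono) (simp add: mult.commute[of t] mult_left_mono t)
  also have "\<dots> = (\<Sum>u\<in>S ` A. real (length u) * w u)"
    using inj by (simp add: sum.reindex)
  also have "\<dots> \<le> (\<Sum>u\<in>(\<Union>n<J. bad n). real (length u) * w u)"
    using A J dev fin by (intro sum_mono2) (auto simp: w0, auto simp: bad_def words_def)
  also have "\<dots> = (\<Sum>n<J. \<Sum>u\<in>bad n. real (length u) * w u)"
    using fin by (intro sum.UNION_disjoint) (auto, auto simp: bad_def words_def)
  also have "\<dots> = (\<Sum>n<J. real n * (\<Sum>u\<in>bad n. w u))"
    unfolding sum_distrib_left by (intro sum.cong refl) (auto simp: bad_def words_def)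
  also have "\<dots> \<le> (\<Sum>n. real n * (\<Sum>u\<in>bad n. w u))"
    using summable_deviant_weight[OF s \<epsilon>] w0
    by (intro sum_le_suminf) (auto simp: bad_def intro!: mult_nonneg_nonneg sum_nonneg)
  finally show ?thesis unfolding bad_def .
qed

text \<open>
  Cutting inside the string \<open>S n\<close>, the deviation of the prefix is at most \<open>\<epsilon>\<close> times its length, plus
  a constant multiple of \<open>n + 1\<close> for the deviant strings and the junctions, plus \<open>length (S n)\<close>.
  The order enters through \<open>w (S n) \<le> w (S i)\<close> for \<open>i < n\<close> and \<open>1 \<le> r * w (S n) * (n + 1)\<close>; both hold
  however ties between strings of equal weight are broken.
\<close>

lemma enumeration_frequency:
  assumes q: "\<And>d. d \<in> D \<Longrightarrow> p d \<le> q" "q < 1"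
    and bij: "bij_betw S UNIV (digit_strings D)"
    and order: "\<And>i j. w (S j) < w (S i) \<Longrightarrow> i < j"
    and s: "s \<noteq> []" "set s \<subseteq> D"
  shows "(\<lambda>N. real (occ s (map (concat_digits S) [0..<N])) / real N) \<longlonglongrightarrow> w s"
proof -
  have D_ne: "D \<noteq> {}" using sum_p by auto
  then have q0: "0 < q" using q(1) p_pos by (meson all_not_in_conv less_le_trans)
  have S: "S i \<noteq> []" "set (S i) \<subseteq> D" for i
    using bij by (auto simp: bij_betw_def digit_strings_def)
  have S_surj: "\<exists>i. S i = u" if "u \<noteq> []" "set u \<subseteq> D" for u
  proof -
    have "u \<in> range S" using bij that by (simp add: bij_betw_def digit_strings_def)
    then show ?thesis by auto
  qed
  have inj: "inj S" using bij by (simp add: bij_betw_def)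
  define r where "r = real (card D)"
  have r: "0 < r" using D_ne finite_D by (simp add: r_def card_gt_0_iff)
  \<comment> \<open>The heavy words at level \<open>w (S n)\<close> are the empty word and some of \<open>S 0, \<dots>, S (n - 1)\<close>.\<close>
  have many: "1 \<le> r * w (S n) * real (n + 1)" for n
  proof -
    have pos: "0 < w (S n)" by (rule weight_pos[OF S(2)])
    have "w (S n) \<le> q ^ length (S n)" using weight_le_power[OF q(1) _ S(2)] q0 by simp
    also have "\<dots> < 1" using power_strict_decreasing[of 0 "length (S n)" q] q(2) q0 S(1) by simp
    finally have lt: "w (S n) < 1" .
    have "1 \<le> real (card D) * w (S n) * real (card (insert [] (S ` {..<n})))"
    proof (rule heavy_words_lower_bound[OF q(1) _ q(2) pos lt])
      fix v assume v: "set v \<subseteq> D" "w (S n) < w v"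
      show "v \<in> insert [] (S ` {..<n})"
        using S_surj[of v] v order[of n] by (cases "v = []") auto
    qed (use q0 in auto)
    also have "\<dots> \<le> real (card D) * w (S n) * real (n + 1)"
      using card_insert_le_m1[of "n + 1" "S ` {..<n}" "[]"] card_image_le[of "{..<n}" S] pos
      by (intro mult_left_mono of_nat_mono) auto
    finally show ?thesis by (simp add: r_def)
  qed
  have length_at_top: "filterlim (\<lambda>n. length (S n)) at_top sequentially"
    unfolding filterlim_at_top
  proof
    fix L
    have "finite (S -` {u. set u \<subseteq> D \<and> length u \<le> L})"
      using finite_lists_length_le[OF finite_D] inj by (intro finite_vimageI)
    then have "finite {n. \<not> L \<le> length (S n)}"
      by (rule rev_finite_subset) (use S in auto)
    then show "eventually (\<lambda>n. L \<le> length (S n)) sequentially"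
      by (simp add: cofinite_eq_sequentially[symmetric] eventually_cofinite)
  qed
  define \<Lambda> where "\<Lambda> n = length (concat_first S n)" for n
  \<comment> \<open>Since \<open>w (S n)\<close> is at most \<open>q\<close> to the power \<open>length (S n)\<close>, the length of \<open>S n\<close> is at most
    logarithmic in \<open>n\<close>; the linear bound is enough.\<close>
  have last_short: "eventually (\<lambda>n. real (length (S n)) \<le> real (n + 1)) sequentially"
  proof -
    have "(\<lambda>n. real n * q ^ n) \<longlonglongrightarrow> 0" using q0 q(2) by (intro powser_times_n_limit_0) simp
    then have "(\<lambda>n. r * (real (length (S n)) * q ^ length (S n))) \<longlonglongrightarrow> r * 0"
      using length_at_top by (intro tendsto_mult_left) (rule filterlim_compose)
    then have "eventually (\<lambda>n. r * (real (length (S n)) * q ^ length (S n)) < 1) sequentially"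
      by (rule order_tendstoD) simp
    then show ?thesis
    proof eventually_elim
      case (elim n)
      have "real (length (S n)) \<le> real (length (S n)) * (r * w (S n) * real (n + 1))"
        using many[of n] by (simp add: mult_le_cancel_left1)
      also have "\<dots> = r * (real (length (S n)) * w (S n)) * real (n + 1)" by simp
      also have "\<dots> \<le> r * (real (length (S n)) * q ^ length (S n)) * real (n + 1)"
        using r q0 weight_le_power[OF q(1) _ S(2)] by (intro mult_right_mono mult_left_mono) auto
      also have "\<dots> \<le> 1 * real (n + 1)" using elim by (intro mult_right_mono) auto
      finally show ?case by simp
    qed
  qed
  \<comment> \<open>The average length of the strings tends to infinity.\<close>
  have long: "eventually (\<lambda>n. M * real (n + 1) \<le> real (\<Lambda> n)) sequentially" for M :: real
  proof -
    obtain L :: nat where L: "M \<le> real L" using real_arch_simple by blast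
    have "eventually (\<lambda>n. 2 * L \<le> length (S n)) sequentially"
      using length_at_top by (simp add: filterlim_at_top)
    then obtain m where m: "\<And>n. m \<le> n \<Longrightarrow> 2 * L \<le> length (S n)"
      by (auto simp: eventually_sequentially)
    have grow: "2 * L * k \<le> \<Lambda> (m + k)" for k
    proof (induction k)
      case (Suc k)
      then show ?case using m[of "m + k"] by (simp add: \<Lambda>_def)
    qed simp
    show ?thesis
      using eventually_ge_at_top[of "2 * m + 1"]
    proof eventually_elim
      case (elim n)
      have "L * (n + 1) \<le> L * (2 * (n - m))" using elim by (intro mult_left_mono) auto
      also have "\<dots> \<le> \<Lambda> n" using grow[of "n - m"] elim by (simp add: mult_ac)
      finally have "real (L * (n + 1)) \<le> real (\<Lambda> n)" by (rule of_nat_mono)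
      moreover have "M * real (n + 1) \<le> real L * real (n + 1)" using L by (intro mult_right_mono) auto
      ultimately show ?case by (simp only: of_nat_mult)
    qed
  qed
  \<comment> \<open>One \<open>\<epsilon>\<close> is for the strings that are not deviant, the other for all error terms together.\<close>
  have small: "eventually (\<lambda>N. deviation s (map (concat_digits S) [0..<N]) \<le> 2 * \<epsilon> * real N) sequentially"
    if \<epsilon>: "0 < \<epsilon>" for \<epsilon>
  proof -
    define K where "K = (\<Sum>n. real n * (\<Sum>u\<in>{u \<in> words D n. \<epsilon> * real (length u) \<le> deviation s u}. w u))"
    define M where "M = K * r + real (length s) + 1"
    have bound: "deviation s (map (concat_digits S) [0..<N])
        \<le> \<epsilon> * real (\<Lambda> n) + (K * r + real (length s)) * real (n + 1) + real (length (S n))"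
      if N: "\<Lambda> n \<le> N" "N < \<Lambda> (Suc n)" for n N
    proof -
      define A where "A = {i. i < n \<and> \<epsilon> * real (length (S i)) \<le> deviation s (S i)}"
      have finA: "finite A" by (simp add: A_def)
      have t: "w (S n) \<le> w (S i)" if "i < n" for i
        using order[of i n] order[of n i] that by (meson not_less_iff_gr_or_eq not_le)
      have "w (S n) * (\<Sum>i\<in>A. real (length (S i))) \<le> K"
        unfolding K_def
        by (rule deviant_length_bound[OF _ finA S(2) _ _ s \<epsilon>])
          (use inj t in \<open>auto simp: A_def intro: inj_on_subset\<close>)
      then have "r * real (n + 1) * (w (S n) * (\<Sum>i\<in>A. real (length (S i)))) \<le> r * real (n + 1) * K"
        using r by (intro mult_left_mono) auto
      moreover have "1 * (\<Sum>i\<in>A. real (length (S i)))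
          \<le> (r * w (S n) * real (n + 1)) * (\<Sum>i\<in>A. real (length (S i)))"
        by (rule mult_right_mono[OF many]) (simp add: sum_nonneg)
      ultimately have badlen: "(\<Sum>i\<in>A. real (length (S i))) \<le> K * r * real (n + 1)"
        by (simp add: mult_ac)
      have "(\<Sum>i<n. deviation s (S i))
          \<le> (\<Sum>i<n. \<epsilon> * real (length (S i)) + (if i \<in> A then real (length (S i)) else 0))"
      proof (rule sum_mono)
        fix i assume "i \<in> {..<n}"
        then show "deviation s (S i) \<le> \<epsilon> * real (length (S i)) + (if i \<in> A then real (length (S i)) else 0)"
          using deviation_le_length[OF s, of "S i"] \<epsilon> by (auto simp: A_def intro: add_increasing)
      qed
      also have "\<dots> = \<epsilon> * real (\<Lambda> n) + (\<Sum>i\<in>A. real (length (S i)))"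
        by (simp add: sum.distrib sum_distrib_left[symmetric] \<Lambda>_def length_concat_first sum.If_cases)
          (simp add: A_def Int_def)
      finally have full: "(\<Sum>i<n. deviation s (S i)) \<le> \<epsilon> * real (\<Lambda> n) + K * r * real (n + 1)"
        using badlen by linarith
      have "map (concat_digits S) [0..<N] = concat_first S n @ take (N - \<Lambda> n) (S n)"
        using map_concat_digits[of S N "Suc n"] S(1) N by (simp add: \<Lambda>_def)
      then have "deviation s (map (concat_digits S) [0..<N])
          \<le> deviation s (concat_first S n) + deviation s (take (N - \<Lambda> n) (S n)) + real (length s)"
        using deviation_append[OF s(1)] by simp
      moreover have "deviation s (take (N - \<Lambda> n) (S n)) \<le> real (length (S n))"
        using deviation_le_length[OF s, of "take (N - \<Lambda> n) (S n)"] by simp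
      ultimately show ?thesis
        using deviation_concat_first[OF s(1), of S n] full by (simp add: algebra_simps)
    qed
    have "eventually (\<lambda>n. M / \<epsilon> * real (n + 1) \<le> real (\<Lambda> n) \<and> real (length (S n)) \<le> real (n + 1)) sequentially"
      using long last_short by (rule eventually_conj)
    then obtain n0 where n0: "\<And>n. n0 \<le> n \<Longrightarrow> M / \<epsilon> * real (n + 1) \<le> real (\<Lambda> n)"
      "\<And>n. n0 \<le> n \<Longrightarrow> real (length (S n)) \<le> real (n + 1)"
      by (auto simp: eventually_sequentially)
    show ?thesis
      using eventually_ge_at_top[of "\<Lambda> n0"]
    proof eventually_elim
      case (elim N)
      then obtain n where n: "n0 \<le> n" "\<Lambda> n \<le> N" "N < \<Lambda> (Suc n)"
        using containing_block[of S n0 N, OF S(1)] unfolding \<Lambda>_def by blast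
      have "M * real (n + 1) \<le> \<epsilon> * real (\<Lambda> n)" using n0(1)[OF n(1)] \<epsilon> by (simp add: field_simps)
      then have "deviation s (map (concat_digits S) [0..<N]) \<le> 2 * \<epsilon> * real (\<Lambda> n)"
        using bound[OF n(2,3)] n0(2)[OF n(1)] by (simp add: M_def algebra_simps)
      also have "\<dots> \<le> 2 * \<epsilon> * real N" using n(2) \<epsilon> by simp
      finally show ?case .
    qed
  qed
  show ?thesis
  proof (rule tendstoI)
    fix e :: real assume e: "0 < e"
    have "eventually (\<lambda>N. deviation s (map (concat_digits S) [0..<N]) \<le> 2 * (e / 4) * real N) sequentially"
      using small[of "e / 4"] e by simp
    then show "eventually (\<lambda>N. dist (real (occ s (map (concat_digits S) [0..<N])) / real N) (w s) < e) sequentially"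
      using eventually_gt_at_top[of 0]
    proof eventually_elim
      case (elim N)
      let ?x = "real (occ s (map (concat_digits S) [0..<N]))"
      have "dist (?x / real N) (w s) = \<bar>?x - w s * real N\<bar> / real N"
      proof -
        have "?x / real N - w s = (?x - w s * real N) / real N"
          using elim(2) by (simp add: diff_divide_distrib)
        then show ?thesis by (simp add: dist_real_def)
      qed
      also have "\<dots> \<le> e / 2" using elim by (simp add: deviation_def field_simps)
      also have "\<dots> < e" using e by simp
      finally show ?case .
    qed
  qed
qed

end

section \<open>Cylinders\<close>

context ergodic_fibred_system
begin

abbreviation cyl :: "nat list \<Rightarrow> 'a set" where "cyl \<equiv> cylinder M T D I"
abbreviation \<mu> :: "nat list \<Rightarrow> real" where "\<mu> \<equiv> cyl_measure M T D I"

lemma digit_unique: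
  assumes "x \<in> I d" "x \<in> I e" "d \<in> D" "e \<in> D" shows "d = e"
  using assms I_disjoint by (auto simp: disjoint_family_on_def)

text \<open>
  Since the sets \<open>I d\<close> are disjoint, the expansion of a point is unique, and its existence can be
  separated from the condition on the first digits.
\<close>

lemma cylinder_eq:
  assumes "set s \<subseteq> D"
  shows "cyl s = {x \<in> space M. (\<forall>n. \<exists>d\<in>D. (T ^^ n) x \<in> I d) \<and> (\<forall>i<length s. (T ^^ i) x \<in> I (s ! i))}"
proof (intro set_eqI iffI)
  fix x assume "x \<in> {x \<in> space M. (\<forall>n. \<exists>d\<in>D. (T ^^ n) x \<in> I d) \<and> (\<forall>i<length s. (T ^^ i) x \<in> I (s ! i))}"
  then have x: "x \<in> space M" "\<And>i. i < length s \<Longrightarrow> (T ^^ i) x \<in> I (s ! i)"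
    and "\<forall>n. \<exists>d. d \<in> D \<and> (T ^^ n) x \<in> I d" by auto
  then obtain d where d: "\<And>n. d n \<in> D" "\<And>n. (T ^^ n) x \<in> I (d n)" by metis
  have "d i = s ! i" if "i < length s" for i
    using digit_unique[OF d(2) x(2)[OF that] d(1)] nth_mem[OF that] assms by blast
  then show "x \<in> cyl s" using x(1) d by (auto simp: cylinder_def has_expansion_def)
next
  fix x assume "x \<in> cyl s"
  then obtain d where "x \<in> space M" "\<And>n. d n \<in> D \<and> (T ^^ n) x \<in> I (d n)"
    "\<And>i. i < length s \<Longrightarrow> d i = s ! i"
    by (auto simp: cylinder_def has_expansion_def)
  then show "x \<in> {x \<in> space M. (\<forall>n. \<exists>d\<in>D. (T ^^ n) x \<in> I d) \<and> (\<forall>i<length s. (T ^^ i) x \<in> I (s ! i))}"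
    by (smt (verit, best) mem_Collect_eq)
qed

lemma cylinder_Cons:
  assumes "d \<in> D" "set s \<subseteq> D"
  shows "cyl (d # s) = I d \<inter> (T -` cyl s \<inter> space M)"
proof -
  have T: "T x \<in> space M" if "x \<in> space M" for x using measurable_space[OF T_measurable that] .
  show ?thesis
  proof (intro set_eqI)
    fix x
    let ?P = "\<lambda>n x. \<exists>e\<in>D. (T ^^ n) x \<in> I e"
    have "(\<forall>n. ?P n x) \<longleftrightarrow> ?P 0 x \<and> (\<forall>n. ?P (Suc n) x)" by (metis not0_implies_Suc)
    also have "\<dots> \<longleftrightarrow> ?P 0 x \<and> (\<forall>n. ?P n (T x))" by (simp add: funpow_swap1)
    finally have all: "(\<forall>n. ?P n x) \<longleftrightarrow> ?P 0 x \<and> (\<forall>n. ?P n (T x))" .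
    have digits: "(\<forall>i<length (d # s). (T ^^ i) x \<in> I ((d # s) ! i))
        \<longleftrightarrow> x \<in> I d \<and> (\<forall>i<length s. (T ^^ i) (T x) \<in> I (s ! i))"
      by (simp add: All_less_Suc2 funpow_swap1)
    have "x \<in> cyl (d # s) \<longleftrightarrow>
        x \<in> space M \<and> (?P 0 x \<and> (\<forall>n. ?P n (T x))) \<and> x \<in> I d \<and> (\<forall>i<length s. (T ^^ i) (T x) \<in> I (s ! i))"
      using assms by (subst cylinder_eq) (simp_all only: mem_Collect_eq all digits set_simps insert_subset simp_thms)
    also have "\<dots> \<longleftrightarrow> x \<in> I d \<and> x \<in> space M \<and> T x \<in> cyl s"
      using assms T[of x] by (subst cylinder_eq) auto
    finally show "x \<in> cyl (d # s) \<longleftrightarrow> x \<in> I d \<inter> (T -` cyl s \<inter> space M)" by blast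
  qed
qed

lemma cylinder_snoc:
  assumes "d \<in> D" "set s \<subseteq> D"
  shows "cyl (s @ [d]) = {x \<in> cyl s. (T ^^ length s) x \<in> I d}"
  using assms by (subst (1 2) cylinder_eq) (auto simp: nth_append less_Suc_eq)

lemma cylinder_measurable: "set s \<subseteq> D \<Longrightarrow> cyl s \<in> sets M"
proof (induction s)
  case Nil
  have "(T ^^ n) -` (\<Union>d\<in>D. I d) \<inter> space M \<in> sets M" for n
    using I_measurable measurable_compose_n[OF T_measurable, of n]
    by (intro measurable_sets[of _ M M] sets.countable_UN') auto
  then have "(\<Inter>n. (T ^^ n) -` (\<Union>d\<in>D. I d) \<inter> space M) \<in> sets M"
    by (intro sets.countable_INT) auto
  moreover have "cyl [] = (\<Inter>n. (T ^^ n) -` (\<Union>d\<in>D. I d) \<inter> space M)"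
    by (subst cylinder_eq) auto
  ultimately show ?case by simp
next
  case (Cons d s)
  then show ?case
    using I_measurable measurable_sets[OF T_measurable] by (auto simp: cylinder_Cons)
qed

text \<open>
  The sets \<open>I d\<close> cut the preimage of the cylinder of \<open>s\<close> into the cylinders of \<open>d # s\<close>, up to a null
  set; the preimage has the measure of the cylinder by invariance.
\<close>

lemma cyl_measure_left:
  assumes "finite D" "set s \<subseteq> D"
  shows "(\<Sum>d\<in>D. \<mu> (d # s)) = \<mu> s"
proof -
  let ?A = "T -` cyl s \<inter> space M"
  have A: "?A \<in> sets M" using measurable_sets[OF T_measurable cylinder_measurable[OF assms(2)]] .
  have "(\<Sum>d\<in>D. \<mu> (d # s)) = (\<Sum>d\<in>D. measure M (I d \<inter> ?A))"
    using assms by (intro sum.cong refl) (simp add: cyl_measure_def cylinder_Cons)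
  also have "\<dots> = measure M (\<Union>d\<in>D. I d \<inter> ?A)"
    using assms(1) A I_measurable I_disjoint
    by (intro finite_measure_finite_Union[symmetric]) (auto simp: disjoint_family_on_def)
  also have "\<dots> = measure M ?A"
  proof (rule finite_measure_eq_AE)
    show "AE x in M. (x \<in> (\<Union>d\<in>D. I d \<inter> ?A)) = (x \<in> ?A)"
      using I_cover by eventually_elim auto
    show "(\<Union>d\<in>D. I d \<inter> ?A) \<in> sets M"
      using assms(1) A I_measurable by (intro sets.finite_UN) auto
  qed (rule A)
  also have "\<dots> = \<mu> s"
    using T_invariant[OF cylinder_measurable[OF assms(2)]] by (simp add: cyl_measure_def measure_def)
  finally show ?thesis .
qed

lemma cyl_measure_right:
  assumes "finite D" "set s \<subseteq> D"
  shows "(\<Sum>d\<in>D. \<mu> (s @ [d])) = \<mu> s"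
proof -
  have "(\<Sum>d\<in>D. \<mu> (s @ [d])) = measure M (\<Union>d\<in>D. cyl (s @ [d]))"
    unfolding cyl_measure_def
  proof (intro finite_measure_finite_Union[symmetric])
    show "(\<lambda>d. cyl (s @ [d])) ` D \<subseteq> sets M"
      using assms by (intro image_subsetI cylinder_measurable) auto
    show "disjoint_family_on (\<lambda>d. cyl (s @ [d])) D"
      using assms digit_unique by (auto simp: disjoint_family_on_def cylinder_snoc)
  qed (rule assms)
  also have "(\<Union>d\<in>D. cyl (s @ [d])) = cyl s"
    using assms by (auto simp: cylinder_snoc) (auto simp: cylinder_eq)
  finally show ?thesis by (simp add: cyl_measure_def)
qed

text \<open>
  If the sum is \<open>m\<close>, then the cylinders of each length have total measure \<open>m\<close> while the product weights of
  the words of length \<open>n\<close> add up to the \<open>n\<close>-th power of \<open>m\<close>. Hence these powers are bounded above and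
  away from 0, which forces \<open>m = 1\<close>.
\<close>

lemma bounds_imp_sum_eq_1:
  assumes D: "finite D" "D \<noteq> {}" and pos: "\<And>d. d \<in> D \<Longrightarrow> 0 < \<mu> [d]" and c: "0 < c1" "0 < c2"
    and lower: "\<And>s. s \<noteq> [] \<Longrightarrow> set s \<subseteq> D \<Longrightarrow> c1 * weight (\<lambda>d. \<mu> [d]) s \<le> \<mu> s"
    and upper: "\<And>s. s \<noteq> [] \<Longrightarrow> set s \<subseteq> D \<Longrightarrow> \<mu> s \<le> c2 * weight (\<lambda>d. \<mu> [d]) s"
  shows "(\<Sum>d\<in>D. \<mu> [d]) = 1"
proof -
  define m where "m = (\<Sum>d\<in>D. \<mu> [d])"
  have m0: "0 < m" unfolding m_def using D pos by (intro sum_pos) auto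
  have mass: "(\<Sum>u\<in>words D n. \<mu> u) = m" for n
    using sum_words_prefix[of D \<mu> "[]" n] cyl_measure_left[OF D(1)] cyl_measure_left[OF D(1), of "[]"]
    by (simp add: m_def)
  have ne: "u \<noteq> [] \<and> set u \<subseteq> D" if "u \<in> words D (Suc n)" for u n using that by (auto simp: words_def)
  have "c1 * m ^ Suc n \<le> m" for n
  proof -
    have "c1 * m ^ Suc n = (\<Sum>u\<in>words D (Suc n). c1 * weight (\<lambda>d. \<mu> [d]) u)"
      by (simp only: sum_distrib_left[symmetric] sum_weight_words m_def)
    also have "\<dots> \<le> (\<Sum>u\<in>words D (Suc n). \<mu> u)" using ne by (intro sum_mono lower) auto
    finally show ?thesis using mass by simp
  qed
  then have le: "m ^ n \<le> 1 / c1" for n using m0 c(1) by (simp add: field_simps)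
  have "m \<le> c2 * m ^ Suc n" for n
  proof -
    have "(\<Sum>u\<in>words D (Suc n). \<mu> u) \<le> (\<Sum>u\<in>words D (Suc n). c2 * weight (\<lambda>d. \<mu> [d]) u)"
      using ne by (intro sum_mono upper) auto
    also have "\<dots> = c2 * m ^ Suc n"
      by (simp only: sum_distrib_left[symmetric] sum_weight_words m_def)
    finally show ?thesis using mass by simp
  qed
  then have ge: "1 / c2 \<le> m ^ n" for n using m0 c(2) by (simp add: field_simps)
  have "\<not> 1 < m" using real_arch_pow[of m "1 / c1"] le by (meson not_le)
  moreover have "\<not> m < 1" using real_arch_pow_inv[of "1 / c2" m] ge c(2) by (meson not_le zero_less_divide_1_iff)
  ultimately show ?thesis by (simp add: m_def)
qed

end

section \<open>Normality\<close>

theorem theorem1p3: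
  fixes M :: "'a measure" and T :: "'a \<Rightarrow> 'a" and D :: "nat set" and I :: "nat \<Rightarrow> 'a set"
    and c1 c2 :: real and S :: "nat \<Rightarrow> nat list"
  assumes "ergodic_fibred_system M T D I"
    and "finite D"
    and "\<And>d. d \<in> D \<Longrightarrow> cyl_measure M T D I [d] > 0"
    and "0 < c1" and "c1 \<le> c2"
    and "\<And>s. s \<in> digit_strings D \<Longrightarrow>
           c1 * (\<Prod>i<length s. cyl_measure M T D I [s ! i]) \<le> cyl_measure M T D I s"
    and "\<And>s. s \<in> digit_strings D \<Longrightarrow>
           cyl_measure M T D I s \<le> c2 * (\<Prod>i<length s. cyl_measure M T D I [s ! i])"
    and "bij_betw S UNIV (digit_strings D)"
    and "\<And>i j. cyl_measure M T D I (S i) > cyl_measure M T D I (S j) \<Longrightarrow> i < j"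
  shows "T_normal M T D I (concat_digits S)"
proof -
  interpret ergodic_fibred_system M T D I by fact
  define p where "p = (\<lambda>d. \<mu> [d])"
  have ds: "s \<in> digit_strings D \<longleftrightarrow> s \<noteq> [] \<and> set s \<subseteq> D" for s by (simp add: digit_strings_def)
  have S: "S i \<noteq> []" "set (S i) \<subseteq> D" for i
    using assms(8) ds by (auto simp: bij_betw_def)
  have D_ne: "D \<noteq> {}" using S[of 0] by auto
  have lower: "c1 * weight p s \<le> \<mu> s" and upper: "\<mu> s \<le> c2 * weight p s"
    if "s \<noteq> []" "set s \<subseteq> D" for s
    using assms(6,7)[of s] that by (simp_all add: ds weight_eq_prod p_def)
  have sum_p: "(\<Sum>d\<in>D. p d) = 1"
    unfolding p_def
    by (rule bounds_imp_sum_eq_1[of c1 c2]) (use assms D_ne lower upper in \<open>auto simp: p_def\<close>)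
  interpret digit_weights D p
    by unfold_locales (use assms(2,3) sum_p in \<open>auto simp: p_def\<close>)
  have total: "\<mu> [] = 1" using cyl_measure_left[OF assms(2), of "[]"] sum_p by (simp add: p_def)
  have product: "\<mu> s = w s" if "s \<noteq> []" "set s \<subseteq> D" for s
    by (rule consistent_weight_unique[of \<mu> c2])
      (use that total upper cyl_measure_left cyl_measure_right assms(2) in \<open>auto simp: cyl_measure_def\<close>)
  show ?thesis
    unfolding T_normal_def
  proof
    fix s assume "s \<in> digit_strings D"
    then have s: "s \<noteq> []" "set s \<subseteq> D" by (simp_all add: ds)
    have count: "card {n. n + length s \<le> N \<and> (\<forall>i<length s. concat_digits S (n + i) = s ! i)}
        = occ s (map (concat_digits S) [0..<N])" for N
      unfolding occ_def by (rule arg_cong[where f = card]) auto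
    have "(\<lambda>N. real (occ s (map (concat_digits S) [0..<N])) / real N) \<longlonglongrightarrow> w s"
    proof (cases "\<exists>a. D = {a}")
      case True
      have "concat_digits S n \<in> D" for n
      proof -
        have "n < length (concat_first S (Suc n))" using concat_first_long[of S "Suc n", OF S(1)] by simp
        then have "concat_digits S n \<in> set (concat_first S (Suc n))"
          using concat_digits_nth[of S n "Suc n", OF S(1)] by (simp only: nth_mem)
        then show ?thesis using S(2) by (auto simp: concat_first_def)
      qed
      moreover obtain a where "D = {a}" using True by blast
      ultimately show ?thesis using s by (intro one_digit_frequency)
    next
      case False
      have "p d < 1" if d: "d \<in> D" for d
      proof -
        obtain e where e: "e \<in> D" "e \<noteq> d" using False d by blast
        have "p d + p e = (\<Sum>x\<in>{d, e}. p x)" using e by simp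
        also have "\<dots> \<le> (\<Sum>x\<in>D. p x)"
          using d e finite_D p_pos by (intro sum_mono2) (auto intro: less_imp_le)
        finally show ?thesis using p_pos[OF e(1)] sum_p by simp
      qed
      then have "Max (p ` D) < 1" using finite_D D_ne by simp
      then show ?thesis
      proof (rule enumeration_frequency[rotated])
        show "p d \<le> Max (p ` D)" if "d \<in> D" for d using finite_D that by simp
        show "i < j" if "w (S j) < w (S i)" for i j
          by (rule assms(9)) (simp only: product[OF S] that)
      qed (fact assms(8) s)+
    qed
    then show "(\<lambda>N. real (card {n. n + length s \<le> N \<and> (\<forall>i<length s. concat_digits S (n + i) = s ! i)}) / real N)
        \<longlonglongrightarrow> \<mu> s"
      using product[OF s] by (simp add: count)
  qed
qed

end
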